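(* For all positive integers $n$ and any two subsets $S,T\subseteq[n]$, the matrix $M_n^{\mathrm{LMAX}=S,\mathrm{LMIN}=T}(132)$ is Hankel. Consequently, the distribution of the quadruple $(\mathrm{LMAX},\mathrm{LMIN},\mathsf{iar},\mathsf{comp})$ is equal to that of $(\mathrm{LMAX},\mathrm{LMIN},\mathsf{comp},\mathsf{iar})$ over $\mathfrak{S}_n(132)$; in terms of generating functions, $$\sum_{\pi\in\mathfrak{S}_n(132)}\mathbf{x}^{\mathrm{LMAX}(\pi)}\mathbf{y}^{\mathrm{LMIN}(\pi)}r^{\mathsf{iar}(\pi)}p^{\mathsf{comp}(\pi)}=\sum_{\pi\in\mathfrak{S}_n(132)}\mathbf{x}^{\mathrm{LMAX}(\pi)}\mathbf{y}^{\mathrm{LMIN}(\pi)}r^{\mathsf{comp}(\pi)}p^{\mathsf{iar}(\pi)}.$$ In particular, $$\sum_{\pi\in\mathfrak{S}_n(132)}t^{\mathsf{des}(\pi)}r^{\mathsf{iar}(\pi)}p^{\mathsf{comp}(\pi)}=\sum_{\pi\in\mathfrak{S}_n(132)}t^{\mathsf{des}(\pi)}r^{\mathsf{comp}(\pi)}p^{\mathsf{iar}(\pi)}.$$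
   Context: $\mathfrak{S}_n$ is the set of permutations $\pi=\pi(1)\cdots\pi(n)$ of $[n]=\{1,\dots,n\}$. A permutation $\pi\in\mathfrak{S}_n$ contains the pattern $\sigma\in\mathfrak{S}_k$ if there are $j_1<\cdots<j_k$ such that $\pi(j_a)<\pi(j_b)$ if and only if $\sigma(a)<\sigma(b)$ for all $1\le a<b\le k$; otherwise it avoids $\sigma$. $\mathfrak{S}_n(132)$ is the set of $\pi\in\mathfrak{S}_n$ avoiding $132$. For $\pi\in\mathfrak{S}_n$: $\mathrm{DES}(\pi)=\{i\in[n-1]:\pi(i)>\pi(i+1)\}$, $\mathsf{des}(\pi)=|\mathrm{DES}(\pi)|$, $\mathsf{iar}(\pi)=\min(\mathrm{DES}(\pi)\cup\{n\})$, $\mathsf{comp}(\pi)=|\{i\in[n]:\pi(j)\le i\text{ for all }j\le i\}|$, $\mathrm{LMAX}(\pi)=\{\pi(i):\pi(j)<\pi(i)\text{ for all }1\le j<i\}$, $\mathrm{LMIN}(\pi)=\{\pi(i):\pi(j)>\pi(i)\text{ for all }1\le j<i\}$. For a set $S\subseteq[n]$, $\mathbf{x}^S=\prod_{i\in S}x_i$ and $\mathbf{y}^S=\prod_{i\in S}y_i$. $M_n^{\mathrm{LMAX}=S,\mathrm{LMIN}=T}(132)$ is the $n\times n$ matrix whose $(k,\ell)$-entry is the number of $\pi\in\mathfrak{S}_n(132)$ with $\mathrm{LMAX}(\pi)=S$, $\mathrm{LMIN}(\pi)=T$, $\mathsf{iar}(\pi)=k$ and $\mathsf{comp}(\pi)=\ell$.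 A square matrix is Hankel if it has constant skew-diagonals, i.e. its $(k,\ell)$-entry depends only on $k+\ell$. *)

theory Defs
  imports
    "HOL-Combinatorics.Permutations"
    "HOL-Library.Poly_Mapping"
    "Jordan_Normal_Form.Matrix"
begin

definition perms :: "nat \<Rightarrow> (nat \<Rightarrow> nat) set" where
  "perms n = {\<pi>. \<pi> permutes {1..n}}"

definition one_line :: "nat list \<Rightarrow> nat \<Rightarrow> nat" where
  "one_line w i = (if i \<in> {1..length w} then w ! (i - 1) else i)"

definition contains_pattern :: "nat \<Rightarrow> (nat \<Rightarrow> nat) \<Rightarrow> nat \<Rightarrow> (nat \<Rightarrow> nat) \<Rightarrow> bool" where
  "contains_pattern n \<pi> k \<sigma> \<longleftrightarrow>
     (\<exists>j. j ` {1..k} \<subseteq> {1..n} \<and> strict_mono_on {1..k} j \<and>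
          (\<forall>a\<in>{1..k}. \<forall>b\<in>{1..k}. a < b \<longrightarrow> (\<pi> (j a) < \<pi> (j b) \<longleftrightarrow> \<sigma> a < \<sigma> b)))"

definition perms_avoiding :: "nat \<Rightarrow> nat list \<Rightarrow> (nat \<Rightarrow> nat) set" where
  "perms_avoiding n w = {\<pi> \<in> perms n. \<not> contains_pattern n \<pi> (length w) (one_line w)}"

abbreviation perms132 :: "nat \<Rightarrow> (nat \<Rightarrow> nat) set" where
  "perms132 n \<equiv> perms_avoiding n [1, 3, 2]"

definition DES :: "nat \<Rightarrow> (nat \<Rightarrow> nat) \<Rightarrow> nat set" where
  "DES n \<pi> = {i \<in> {1..n - 1}. \<pi> i > \<pi> (i + 1)}"

definition des :: "nat \<Rightarrow> (nat \<Rightarrow> nat) \<Rightarrow> nat" where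
  "des n \<pi> = card (DES n \<pi>)"

definition iar :: "nat \<Rightarrow> (nat \<Rightarrow> nat) \<Rightarrow> nat" where
  "iar n \<pi> = Min (DES n \<pi> \<union> {n})"

definition comp_stat :: "nat \<Rightarrow> (nat \<Rightarrow> nat) \<Rightarrow> nat" where
  "comp_stat n \<pi> = card {i \<in> {1..n}. \<forall>j\<in>{1..i}. \<pi> j \<le> i}"

definition LMAX :: "nat \<Rightarrow> (nat \<Rightarrow> nat) \<Rightarrow> nat set" where
  "LMAX n \<pi> = {\<pi> i | i. i \<in> {1..n} \<and> (\<forall>j\<in>{1..<i}. \<pi> j < \<pi> i)}"

definition LMIN :: "nat \<Rightarrow> (nat \<Rightarrow> nat) \<Rightarrow> nat set" where
  "LMIN n \<pi> = {\<pi> i | i. i \<in> {1..n} \<and> (\<forall>j\<in>{1..<i}. \<pi> j > \<pi> i)}"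

definition hankel_mat :: "'a mat \<Rightarrow> bool" where
  "hankel_mat A \<longleftrightarrow> square_mat A \<and>
     (\<forall>i < dim_row A. \<forall>j < dim_col A. \<forall>i' < dim_row A. \<forall>j' < dim_col A.
        i + j = i' + j' \<longrightarrow> A $$ (i, j) = A $$ (i', j'))"

text \<open>Library matrices are indexed from 0, whereas \<^term>\<open>iar n\<close> and \<^term>\<open>comp_stat n\<close>
  take values in \<^term>\<open>{1..n}\<close>: the mathematical $(k,\ell)$-entry sits at index $(k-1,\ell-1)$.\<close>

definition M132 :: "nat \<Rightarrow> nat set \<Rightarrow> nat set \<Rightarrow> nat mat" where
  "M132 n S T = mat n n (\<lambda>(k, l).
     card {\<pi> \<in> perms132 n. LMAX n \<pi> = S \<and> LMIN n \<pi> = T \<and>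
                           iar n \<pi> = k + 1 \<and> comp_stat n \<pi> = l + 1})"

definition equidistributed :: "'a set \<Rightarrow> ('a \<Rightarrow> 'b) \<Rightarrow> ('a \<Rightarrow> 'b) \<Rightarrow> bool" where
  "equidistributed A f g \<longleftrightarrow> (\<forall>v. card {a \<in> A. f a = v} = card {a \<in> A. g a = v})"

datatype indet = Ind_x nat | Ind_y nat | Ind_r | Ind_p | Ind_t

text \<open>Multivariate polynomials over the integers: finitely supported maps from exponent
  vectors to coefficients, with the convolution product of \<^theory>\<open>HOL-Library.Poly_Mapping\<close>.\<close>

type_synonym gf_poly = "(indet \<Rightarrow>\<^sub>0 nat) \<Rightarrow>\<^sub>0 int"

definition indeterminate :: "indet \<Rightarrow> gf_poly" where
  "indeterminate v = Poly_Mapping.single (Poly_Mapping.single v 1) 1"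

abbreviation x_var :: "nat \<Rightarrow> gf_poly" where "x_var i \<equiv> indeterminate (Ind_x i)"
abbreviation y_var :: "nat \<Rightarrow> gf_poly" where "y_var i \<equiv> indeterminate (Ind_y i)"
abbreviation r_var :: gf_poly where "r_var \<equiv> indeterminate Ind_r"
abbreviation p_var :: gf_poly where "p_var \<equiv> indeterminate Ind_p"
abbreviation t_var :: gf_poly where "t_var \<equiv> indeterminate Ind_t"

end

theory Submission
  imports Defs
begin

text \<open>
  Let \<^term>\<open>\<pi>\<close> avoid 132 and put \<open>m = \<pi> 1\<close>. Call a value big if it is at least \<open>m\<close> and small
  otherwise. Two big values in decreasing order would form a 132 together with the first entry, so
  the big values occur in the order \<open>m, m + 1, \<dots>, n\<close> (\<open>values_above_first_increase\<close>). In
  particular the left-to-right maxima are exactly the big values. If \<open>m = 1\<close> then \<^term>\<open>\<pi>\<close> is the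
  identity. If \<open>m > 1\<close>, the initial ascending run consists of the big values before the first
  small one, and each big value after the last small one is a component of its own while
  everything up to the last small value is a single component. So \<open>iar\<close> counts the leading big
  values, and \<open>comp\<close> is one more than the number of trailing big values.

  This suggests to move one trailing big value to the front and to relabel the big values so
  that they still increase: the letters of the word are rotated once, the values
  \<open>m, \<dots>, n\<close> are shifted cyclically, and the result is \<open>last_to_front\<close>. A big value before
  or after all the small ones takes part in no 132, so avoidance is kept. The first entry, hence \<open>LMAX\<close>, and
  the order of the small values, hence \<open>LMIN\<close>, do not change; the descents are merely shifted.
  Meanwhile \<open>iar\<close> grows by one and \<open>comp\<close> drops by one. As rotation and shift are
  invertible, the map is a bijection between the permutations with statistics \<open>(k, l + 1)\<close> and
  those with \<open>(k + 1, l)\<close> (\<open>joint_count_step\<close>), which are neighbours on a skew-diagonal.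

  The Hankel property follows by iteration. A Hankel matrix is symmetric, so exchanging \<open>iar\<close> and
  \<open>comp\<close> preserves the joint distribution, and sums over equidistributed
  statistics agree. The argument is run for any statistic that the rotation preserves,
  which covers both the pair \<open>(LMAX, LMIN)\<close> and \<open>des\<close>.
\<close>

section \<open>Avoiding 132\<close>

lemma perms132_iff:
  "\<pi> \<in> perms132 n \<longleftrightarrow> \<pi> permutes {1..n} \<and>
     (\<forall>i j k. 1 \<le> i \<longrightarrow> i < j \<longrightarrow> j < k \<longrightarrow> k \<le> n \<longrightarrow> \<not> (\<pi> i < \<pi> k \<and> \<pi> k < \<pi> j))"
proof -
  have "contains_pattern n \<pi> (length [1, 3, 2::nat]) (one_line [1, 3, 2]) \<longleftrightarrow>
      (\<exists>i j k. 1 \<le> i \<and> i < j \<and> j < k \<and> k \<le> n \<and> \<pi> i < \<pi> k \<and> \<pi> k < \<pi> j)"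
    if perm: "\<pi> permutes {1..n}"
  proof -
    have three: "{1..length [1, 3, 2::nat]} = {1, 2, 3}"
      by auto
    have word: "one_line [1, 3, 2] 1 = 1" "one_line [1, 3, 2] 2 = 3" "one_line [1, 3, 2] 3 = 2"
      by (simp_all add: one_line_def numeral_eq_Suc)
    show ?thesis
    proof
      assume "contains_pattern n \<pi> (length [1, 3, 2::nat]) (one_line [1, 3, 2])"
      then obtain p where p: "p ` {1, 2, 3} \<subseteq> {1..n}" "strict_mono_on {1, 2, 3::nat} p"
        and pat: "\<forall>a\<in>{1, 2, 3}. \<forall>b\<in>{1, 2, 3}. a < b \<longrightarrow>
          (\<pi> (p a) < \<pi> (p b) \<longleftrightarrow> one_line [1, 3, 2] a < one_line [1, 3, 2] b)"
        unfolding contains_pattern_def three by blast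
      have less: "p 1 < p 2" "p 2 < p 3"
        using p(2) by (auto simp: strict_mono_on_def)
      have "\<pi> (p 1) < \<pi> (p 3)" "\<not> \<pi> (p 2) < \<pi> (p 3)"
        using pat word by auto
      moreover have "\<pi> (p 2) \<noteq> \<pi> (p 3)"
        using permutes_inj[OF perm] less by (metis injD less_irrefl)
      ultimately show "\<exists>i j k. 1 \<le> i \<and> i < j \<and> j < k \<and> k \<le> n \<and> \<pi> i < \<pi> k \<and> \<pi> k < \<pi> j"
        using less p(1) by (intro exI[of _ "p 1"] exI[of _ "p 2"] exI[of _ "p 3"]) auto
    next
      assume "\<exists>i j k. 1 \<le> i \<and> i < j \<and> j < k \<and> k \<le> n \<and> \<pi> i < \<pi> k \<and> \<pi> k < \<pi> j"
      then obtain i j k where ijk: "1 \<le> i" "i < j" "j < k" "k \<le> n" "\<pi> i < \<pi> k" "\<pi> k < \<pi> j"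
        by blast
      define p where "p a = (if a = 1 then i else if a = 2 then j else k)" for a :: nat
      have "p ` {1, 2, 3} \<subseteq> {1..n}" "strict_mono_on {1, 2, 3} p"
        using ijk by (auto simp: p_def strict_mono_on_def)
      moreover have "\<forall>a\<in>{1, 2, 3}. \<forall>b\<in>{1, 2, 3}. a < b \<longrightarrow>
          (\<pi> (p a) < \<pi> (p b) \<longleftrightarrow> one_line [1, 3, 2] a < one_line [1, 3, 2] b)"
        using ijk word by (auto simp: p_def)
      ultimately show "contains_pattern n \<pi> (length [1, 3, 2::nat]) (one_line [1, 3, 2])"
        unfolding contains_pattern_def three by blast
    qed
  qed
  then show ?thesis
    unfolding perms_avoiding_def perms_def by blast
qed

lemma finite_perms132: "finite (perms132 n)"
  unfolding perms_avoiding_def perms_def by (simp add: finite_permutations)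

lemma perms132_permutes: "\<pi> \<in> perms132 n \<Longrightarrow> \<pi> permutes {1..n}"
  unfolding perms132_iff by blast

lemma perms132_avoids:
  assumes "\<pi> \<in> perms132 n" "1 \<le> i" "i < j" "j < k" "k \<le> n" "\<pi> i < \<pi> k" "\<pi> k < \<pi> j"
  shows False
  using assms unfolding perms132_iff by blast

lemma permutes_eq_iff:
  assumes "\<pi> permutes A"
  shows "\<pi> i = \<pi> j \<longleftrightarrow> i = j"
  using permutes_inj[OF assms] by (auto dest: injD)

lemma permutes_bounds:
  assumes "\<pi> permutes {1..n}" "1 \<le> i" "i \<le> n"
  shows "1 \<le> \<pi> i" "\<pi> i \<le> n"
  using permutes_in_image[OF assms(1), of i] assms by auto

lemma permutes_obtain:
  assumes "\<pi> permutes {1..n}" "1 \<le> v" "v \<le> n"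
  obtains i where "1 \<le> i" "i \<le> n" "\<pi> i = v"
  using permutes_image[OF assms(1)] assms(2,3) by (metis atLeastAtMost_iff imageE)

text \<open>
  A decreasing pair of values above the first entry would complete it to a 132.
\<close>

lemma values_above_first_increase:
  assumes \<pi>: "\<pi> \<in> perms132 n" and "1 \<le> i" "i < j" "j \<le> n" "\<pi> 1 \<le> \<pi> j"
  shows "\<pi> i < \<pi> j"
proof (rule ccontr)
  assume "\<not> \<pi> i < \<pi> j"
  then have gt: "\<pi> j < \<pi> i"
    using permutes_eq_iff[OF perms132_permutes[OF \<pi>], of i j] assms by linarith
  then have "i \<noteq> 1"
    using assms by auto
  moreover have "\<pi> 1 \<noteq> \<pi> j"
    using permutes_eq_iff[OF perms132_permutes[OF \<pi>], of 1 j] assms by linarith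
  ultimately show False
    using perms132_avoids[OF \<pi>, of 1 i j] gt assms by linarith
qed

text \<open>
  No value below the first entry is a left-to-right maximum, and the values above it appear in
  increasing order. Hence \<^const>\<open>LMAX\<close> carries no more information than the first entry.
\<close>

lemma LMAX_eq_interval:
  assumes \<pi>: "\<pi> \<in> perms132 n"
  shows "LMAX n \<pi> = {\<pi> 1..n}"
proof (intro Set.set_eqI iffI)
  fix v assume "v \<in> LMAX n \<pi>"
  then obtain i where i: "1 \<le> i" "i \<le> n" "v = \<pi> i" "\<forall>j\<in>{1..<i}. \<pi> j < \<pi> i"
    by (auto simp: LMAX_def)
  then have "\<pi> 1 \<le> \<pi> i"
    by (cases "i = 1") (auto simp: less_imp_le)
  then show "v \<in> {\<pi> 1..n}"
    using i permutes_bounds[OF perms132_permutes[OF \<pi>]] by simp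
next
  fix v assume v: "v \<in> {\<pi> 1..n}"
  have "1 \<le> v"
  proof (cases "n = 0")
    case False
    then show ?thesis
      using v permutes_bounds(1)[OF perms132_permutes[OF \<pi>], of 1] by simp
  next
    case True
    then have "\<pi> 1 = 1"
      using permutes_not_in[OF perms132_permutes[OF \<pi>], of 1] by simp
    then show ?thesis
      using v by simp
  qed
  then obtain i where i: "1 \<le> i" "i \<le> n" "\<pi> i = v"
    using permutes_obtain[OF perms132_permutes[OF \<pi>], of v] v by auto
  then have "\<forall>j\<in>{1..<i}. \<pi> j < \<pi> i"
    using values_above_first_increase[OF \<pi>] v by auto
  then show "v \<in> LMAX n \<pi>"
    using i by (auto simp: LMAX_def)
qed

section \<open>Initial runs and components\<close>

text \<open>
  The ends of the components. Rotation shifts this set by one and drops a single element.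
\<close>

definition COMP :: "nat \<Rightarrow> (nat \<Rightarrow> nat) \<Rightarrow> nat set" where
  "COMP n \<pi> = {i \<in> {1..n}. \<forall>j\<in>{1..i}. \<pi> j \<le> i}"

lemma comp_stat_eq_card: "comp_stat n \<pi> = card (COMP n \<pi>)"
  by (simp add: comp_stat_def COMP_def)

lemma finite_COMP: "finite (COMP n \<pi>)"
  by (simp add: COMP_def)

lemma finite_DES: "finite (DES n \<pi>)"
  by (simp add: DES_def)

lemma last_in_COMP:
  assumes "\<pi> permutes {1..n}" "1 \<le> n"
  shows "n \<in> COMP n \<pi>"
  using permutes_bounds(2)[OF assms(1)] assms(2) by (auto simp: COMP_def)

lemma comp_stat_bounds:
  assumes "\<pi> permutes {1..n}" "1 \<le> n"
  shows "1 \<le> comp_stat n \<pi>" "comp_stat n \<pi> \<le> n"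
proof -
  have "COMP n \<pi> \<noteq> {}"
    using last_in_COMP[OF assms] by blast
  then show "1 \<le> comp_stat n \<pi>"
    using finite_COMP by (simp add: comp_stat_eq_card Suc_le_eq card_gt_0_iff)
  have "card (COMP n \<pi>) \<le> card {1..n}"
    by (rule card_mono) (auto simp: COMP_def)
  then show "comp_stat n \<pi> \<le> n"
    by (simp add: comp_stat_eq_card)
qed

lemma iar_bounds:
  assumes "1 \<le> n"
  shows "1 \<le> iar n \<pi>" "iar n \<pi> \<le> n"
  using assms by (auto simp: iar_def finite_DES) (auto simp: DES_def)

text \<open>
  If the first entry is 1, every value is at least the first entry, so the whole word increases.
\<close>

lemma perms132_first_one:
  assumes \<pi>: "\<pi> \<in> perms132 n" and "\<pi> 1 = 1"
  shows "\<pi> = id"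
proof -
  have pos: "\<pi> 1 \<le> \<pi> i" if "i \<in> {1..n}" for i
    using permutes_bounds(1)[OF perms132_permutes[OF \<pi>], of i] that assms(2) by auto
  have "i \<le> \<pi> i" if "i \<in> {1..n}" for i
    using that
  proof (induction i)
    case (Suc i)
    show ?case
    proof (cases "i = 0")
      case False
      then have "\<pi> i < \<pi> (Suc i)"
        using values_above_first_increase[OF \<pi>, of i "Suc i"] pos[of "Suc i"] Suc.prems by auto
      then show ?thesis
        using Suc False by auto
    qed (use assms(2) in auto)
  qed simp
  then show ?thesis
    using permutes_natset_ge[OF perms132_permutes[OF \<pi>]] by blast
qed

lemma iar_id: "iar n id = n"
  by (simp add: iar_def DES_def)

lemma comp_stat_id: "comp_stat n id = n"
proof -
  have "COMP n id = {1..n}"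
    by (auto simp: COMP_def)
  then show ?thesis
    by (simp add: comp_stat_eq_card)
qed

text \<open>
  On the identity both statistics equal \<open>n\<close>. Smaller values therefore rule out the identity, the
  only case in which the first entry is 1.
\<close>

lemma first_gt_one:
  assumes "\<pi> \<in> perms132 n" "1 \<le> n" "iar n \<pi> < n \<or> comp_stat n \<pi> < n"
  shows "1 < \<pi> 1"
proof -
  have "\<pi> 1 \<noteq> 1"
    using perms132_first_one[OF assms(1)] assms(3) by (auto simp: iar_id comp_stat_id)
  then show ?thesis
    using permutes_bounds(1)[OF perms132_permutes[OF assms(1)], of 1] assms(2) by simp
qed

text \<open>
  The value 1 comes after the larger first entry, so there is a descent in between and the
  initial run stops before the end of the word.
\<close>

lemma DES_nonempty:
  assumes \<pi>: "\<pi> permutes {1..n}" and "1 < \<pi> 1" "1 \<le> n"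
  shows "DES n \<pi> \<noteq> {}"
proof
  assume empty: "DES n \<pi> = {}"
  have "\<pi> 1 \<le> \<pi> i" if "1 \<le> i" "i \<le> n" for i
    using that
  proof (induction i rule: dec_induct)
    case (step i)
    then have "i \<notin> DES n \<pi>" "i \<in> {1..n - 1}"
      using empty by auto
    then have "\<pi> i \<le> \<pi> (Suc i)"
      by (simp add: DES_def not_less)
    then show ?case
      using step by auto
  qed simp
  moreover obtain i where "1 \<le> i" "i \<le> n" "\<pi> i = 1"
    using permutes_obtain[OF \<pi>, of 1] assms by auto
  ultimately show False
    using assms(2) by fastforce
qed

lemma iar_eq_Min_DES:
  assumes "DES n \<pi> \<noteq> {}"
  shows "iar n \<pi> = Min (DES n \<pi>)"
proof -
  have "Min (DES n \<pi>) \<in> DES n \<pi>"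
    using assms finite_DES by (rule Min_in[rotated])
  then have "Min (DES n \<pi>) \<le> n"
    unfolding DES_def by auto
  moreover have "Min (DES n \<pi> \<union> {n}) = min (Min (DES n \<pi>)) n"
    using assms finite_DES by (subst Min_Un) auto
  ultimately show ?thesis
    unfolding iar_def by linarith
qed

text \<open>
  If the second entry skipped the value \<open>\<pi> 1 + 1\<close>, that value would come later and play the
  role of 2 in a 132. This is what makes rotation backwards possible.
\<close>

lemma second_eq_Suc_first:
  assumes \<pi>: "\<pi> \<in> perms132 n" and iar: "2 \<le> iar n \<pi>" and n: "2 \<le> n"
  shows "\<pi> 2 = Suc (\<pi> 1)"
proof -
  note perm = perms132_permutes[OF \<pi>]
  have "1 \<notin> DES n \<pi>"
    using iar finite_DES by (auto simp: iar_def)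
  then have "\<pi> 1 \<le> \<pi> 2"
    using n by (simp add: DES_def not_less numeral_2_eq_2)
  moreover have "\<pi> 1 \<noteq> \<pi> 2"
    using permutes_eq_iff[OF perm, of 1 2] by simp
  ultimately have lt: "\<pi> 1 < \<pi> 2"
    by simp
  have "\<pi> 2 \<le> n"
    using permutes_bounds(2)[OF perm, of 2] n by simp
  then obtain p where p: "1 \<le> p" "p \<le> n" "\<pi> p = Suc (\<pi> 1)"
    using permutes_obtain[OF perm, of "Suc (\<pi> 1)"] lt by auto
  have "\<not> 2 < p"
  proof
    assume "2 < p"
    then have "\<pi> p \<noteq> \<pi> 2"
      using permutes_eq_iff[OF perm, of p 2] by simp
    then show False
      using perms132_avoids[OF \<pi>, of 1 2 p] \<open>2 < p\<close> p lt by simp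
  qed
  moreover have "p \<noteq> 1"
    using p by auto
  ultimately have "p = 2"
    using p by simp
  then show ?thesis
    using p by simp
qed

text \<open>
  If the first component ends at \<open>i < n\<close>, then the first entry is at most \<open>i\<close>, so all values after
  position \<open>i\<close> exceed it and increase; the last of them is \<open>n\<close>. This is what makes rotation
  forwards possible.
\<close>

lemma last_fixed:
  assumes \<pi>: "\<pi> \<in> perms132 n" and comp: "2 \<le> comp_stat n \<pi>"
  shows "\<pi> n = n"
proof -
  note perm = perms132_permutes[OF \<pi>]
  have "\<not> COMP n \<pi> \<subseteq> {n}"
    using comp card_mono[of "{n}" "COMP n \<pi>"] by (auto simp: comp_stat_eq_card)
  then obtain i where i: "1 \<le> i" "i < n" "\<forall>j\<in>{1..i}. \<pi> j \<le> i"
    unfolding COMP_def by force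
  have "\<pi> ` {1..i} \<subseteq> {1..i}"
    using i permutes_bounds(1)[OF perm] by fastforce
  moreover have "card (\<pi> ` {1..i}) = card {1..i}"
    using permutes_inj[OF perm] by (intro card_image) (auto intro: inj_on_subset)
  ultimately have image: "\<pi> ` {1..i} = {1..i}"
    by (simp add: card_subset_eq)
  have "\<pi> n \<notin> {1..i}"
  proof
    assume "\<pi> n \<in> {1..i}"
    then obtain j where "j \<in> {1..i}" "\<pi> n = \<pi> j"
      using image by (metis imageE)
    then show False
      using permutes_eq_iff[OF perm, of n j] i by simp
  qed
  moreover have "1 \<le> \<pi> n"
    using permutes_bounds(1)[OF perm, of n] i by simp
  moreover have "\<pi> 1 \<le> i"
    using i by simp
  ultimately have big: "\<pi> 1 \<le> \<pi> n"
    by simp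
  obtain p where p: "1 \<le> p" "p \<le> n" "\<pi> p = n"
    using permutes_obtain[OF perm, of n] i by auto
  have "\<pi> n \<le> n"
    using permutes_bounds(2)[OF perm, of n] i by simp
  then have "\<not> p < n"
    using values_above_first_increase[OF \<pi>, of p n] p(1,3) big by linarith
  then have "p = n"
    using p(2) by simp
  then show ?thesis
    using p(3) by simp
qed

section \<open>Moving the last entry to the front\<close>

text \<open>
  The cyclic permutation \<open>a \<mapsto> a + 1 \<mapsto> \<dots> \<mapsto> b \<mapsto> a\<close>. On positions it rotates words;
  on values it makes room for a new copy of the first entry at the front.
\<close>

definition cycle :: "nat \<Rightarrow> nat \<Rightarrow> nat \<Rightarrow> nat" where
  "cycle a b v = (if a \<le> v \<and> v < b then Suc v else if v = b then a else v)"

text \<open>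
  When \<open>\<pi>\<close> ends with \<open>n\<close>, the relabelling turns that entry into \<open>\<pi> 1\<close>; so the new first
  entry equals the old one. This is why the inverse map can read off the relabelling from the
  first entry of its own argument.
\<close>

definition last_to_front :: "nat \<Rightarrow> (nat \<Rightarrow> nat) \<Rightarrow> nat \<Rightarrow> nat" where
  "last_to_front n \<pi> = cycle (\<pi> 1) n \<circ> \<pi> \<circ> inv_into UNIV (cycle 1 n)"

definition front_to_last :: "nat \<Rightarrow> (nat \<Rightarrow> nat) \<Rightarrow> nat \<Rightarrow> nat" where
  "front_to_last n \<pi> = inv_into UNIV (cycle (\<pi> 1) n) \<circ> \<pi> \<circ> cycle 1 n"

lemma cycle_permutes:
  assumes "1 \<le> a" "a \<le> b"
  shows "cycle a b permutes {1..b}"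
proof -
  have "inj_on (cycle a b) {1..b}"
    by (auto simp: inj_on_def cycle_def split: if_splits)
  moreover have "cycle a b ` {1..b} \<subseteq> {1..b}"
    using assms by (auto simp: cycle_def)
  ultimately have "bij_betw (cycle a b) {1..b} {1..b}"
    by (simp add: bij_betw_def endo_inj_surj)
  moreover have "cycle a b v = v" if "v \<notin> {1..b}" for v
    using assms that by (auto simp: cycle_def)
  ultimately show ?thesis
    by (rule bij_imp_permutes)
qed

lemma inv_cycle_eq:
  assumes "1 \<le> a" "a \<le> b" "cycle a b v = w"
  shows "inv_into UNIV (cycle a b) w = v"
  using permutes_inverses(2)[OF cycle_permutes[OF assms(1,2)], of v] assms(3) by simp

text \<open>
  The permutations that the rotation is applied to: the identity is excluded, and the entry to be
  moved is the largest one.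
\<close>

locale trailing_maximum =
  fixes n :: nat and \<pi> :: "nat \<Rightarrow> nat"
  assumes perm: "\<pi> permutes {1..n}" and first: "1 < \<pi> 1" and last: "\<pi> n = n"
begin

abbreviation "\<sigma> \<equiv> last_to_front n \<pi>"

lemma n_gt_1: "1 < n"
proof -
  have "n \<noteq> 0"
  proof
    assume "n = 0"
    then have "\<pi> 1 = 1"
      using permutes_not_in[OF perm, of 1] by simp
    with first show False
      by simp
  qed
  moreover have "n \<noteq> 1"
    using first last by auto
  ultimately show ?thesis
    by linarith
qed

lemma first_le: "\<pi> 1 \<le> n"
  using permutes_bounds(2)[OF perm, of 1] n_gt_1 by simp

lemma last_to_front_permutes: "\<sigma> permutes {1..n}"
proof -
  have "cycle (\<pi> 1) n permutes {1..n}" "inv_into UNIV (cycle 1 n) permutes {1..n}"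
    using n_gt_1 first first_le cycle_permutes[of "\<pi> 1" n] permutes_inv[OF cycle_permutes[of 1 n]]
    by simp_all
  then show ?thesis
    unfolding last_to_front_def by (metis perm permutes_compose)
qed

lemma last_to_front_first: "\<sigma> 1 = \<pi> 1"
proof -
  have "inv_into UNIV (cycle 1 n) 1 = n"
    using n_gt_1 by (intro inv_cycle_eq) (auto simp: cycle_def)
  then show ?thesis
    by (simp add: last_to_front_def last cycle_def)
qed

lemma last_to_front_Suc:
  assumes "1 \<le> i" "i < n"
  shows "\<sigma> (Suc i) = (if \<pi> i < \<pi> 1 then \<pi> i else Suc (\<pi> i))"
proof -
  have "inv_into UNIV (cycle 1 n) (Suc i) = i"
    using assms n_gt_1 by (intro inv_cycle_eq) (auto simp: cycle_def)
  moreover have "\<pi> i \<noteq> n"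
    using permutes_eq_iff[OF perm, of i n] assms last by simp
  moreover have "\<pi> i \<le> n"
    using permutes_bounds(2)[OF perm, of i] assms by simp
  ultimately show ?thesis
    by (auto simp: last_to_front_def cycle_def)
qed

lemma last_to_front_less_iff:
  assumes "1 \<le> i" "i < n" "1 \<le> j" "j < n"
  shows "\<sigma> (Suc i) < \<sigma> (Suc j) \<longleftrightarrow> \<pi> i < \<pi> j"
  using assms by (auto simp: last_to_front_Suc)

text \<open>
  The maximum at the end of a word cannot be the last letter of a 132. An occurrence starting
  with the new first entry would need two big values in decreasing order. All other
  occurrences correspond to each other, as the relabelling is monotone.
\<close>

lemma last_to_front_avoids_iff: "\<sigma> \<in> perms132 n \<longleftrightarrow> \<pi> \<in> perms132 n"
proof
  assume \<pi>: "\<pi> \<in> perms132 n"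
  have False if ijk: "1 \<le> i" "i < j" "j < k" "k \<le> n" "\<sigma> i < \<sigma> k" "\<sigma> k < \<sigma> j" for i j k
  proof -
    obtain j' k' where Suc: "j = Suc j'" "k = Suc k'"
      using ijk by (metis less_imp_Suc_add)
    have desc: "\<pi> k' < \<pi> j'"
      using last_to_front_less_iff[of k' j'] ijk by (simp add: Suc)
    show False
    proof (cases "i = 1")
      case True
      have "\<pi> 1 \<le> \<pi> k'"
        using ijk(1-5) last_to_front_Suc[of k'] last_to_front_first by (auto simp: True Suc split: if_splits)
      then show False
        using values_above_first_increase[OF \<pi>, of j' k'] desc ijk by (simp add: Suc)
    next
      case False
      then obtain i' where i': "i = Suc i'" "1 \<le> i'"
        using ijk(1) by (cases i) auto
      then have "\<pi> i' < \<pi> k'"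
        using last_to_front_less_iff[of i' k'] ijk by (simp add: Suc)
      then show False
        using perms132_avoids[OF \<pi>, of i' j' k'] desc ijk i' by (simp add: Suc)
    qed
  qed
  then show "\<sigma> \<in> perms132 n"
    unfolding perms132_iff using last_to_front_permutes by blast
next
  assume \<sigma>: "\<sigma> \<in> perms132 n"
  have False if ijk: "1 \<le> i" "i < j" "j < k" "k \<le> n" "\<pi> i < \<pi> k" "\<pi> k < \<pi> j" for i j k
  proof -
    have "k \<noteq> n"
      using ijk last permutes_bounds(2)[OF perm, of j] by auto
    then have "\<sigma> (Suc i) < \<sigma> (Suc k)" "\<sigma> (Suc k) < \<sigma> (Suc j)"
      using ijk by (simp_all add: last_to_front_less_iff)
    then show False
      using perms132_avoids[OF \<sigma>, of "Suc i" "Suc j" "Suc k"] ijk \<open>k \<noteq> n\<close> by simp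
  qed
  then show "\<pi> \<in> perms132 n"
    unfolding perms132_iff using perm by blast
qed

text \<open>
  After the first entry, only small values can be left-to-right minima; they keep their value and
  their relative order.
\<close>

lemma LMIN_last_to_front: "LMIN n \<sigma> = LMIN n \<pi>"
proof (intro Set.set_eqI iffI)
  fix v assume "v \<in> LMIN n \<sigma>"
  then obtain i where i: "1 \<le> i" "i \<le> n" "v = \<sigma> i" "\<forall>j\<in>{1..<i}. \<sigma> i < \<sigma> j"
    by (auto simp: LMIN_def)
  show "v \<in> LMIN n \<pi>"
  proof (cases "i = 1")
    case True
    then show ?thesis
      using i last_to_front_first n_gt_1 by (auto simp: LMIN_def intro!: exI[of _ 1])
  next
    case False
    then obtain i' where i': "i = Suc i'" "1 \<le> i'" "i' < n"
      using i by (cases i) auto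
    have "\<sigma> i < \<sigma> 1"
      using i False by auto
    then have v: "v = \<pi> i'"
      using i' last_to_front_Suc[of i'] last_to_front_first i by (auto split: if_splits)
    have "\<pi> i' < \<pi> j" if "j \<in> {1..<i'}" for j
    proof -
      have "\<sigma> (Suc i') < \<sigma> (Suc j)"
        using i(4) i' that by auto
      then show ?thesis
        using last_to_front_less_iff[of i' j] that i' by auto
    qed
    then show ?thesis
      using v i' by (auto simp: LMIN_def intro!: exI[of _ i'])
  qed
next
  fix v assume "v \<in> LMIN n \<pi>"
  then obtain i where i: "1 \<le> i" "i \<le> n" "v = \<pi> i" "\<forall>j\<in>{1..<i}. \<pi> i < \<pi> j"
    by (auto simp: LMIN_def)
  show "v \<in> LMIN n \<sigma>"
  proof (cases "i = 1")
    case True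
    then show ?thesis
      using i last_to_front_first n_gt_1 by (auto simp: LMIN_def intro!: exI[of _ 1])
  next
    case False
    then have lt: "\<pi> i < \<pi> 1"
      using i by auto
    then have "i < n"
      using i last first_le by (cases "i = n") auto
    have v: "\<sigma> (Suc i) = v"
      using last_to_front_Suc[OF i(1) \<open>i < n\<close>] lt i by simp
    have "\<sigma> (Suc i) < \<sigma> j" if j: "j \<in> {1..<Suc i}" for j
    proof (cases "j = 1")
      case True
      then show ?thesis
        using v lt i last_to_front_first by simp
    next
      case False
      then obtain j' where "j = Suc j'" "1 \<le> j'" "j' < i"
        using j by (cases j) auto
      then show ?thesis
        using last_to_front_less_iff[of i j'] i \<open>i < n\<close> by auto
    qed
    then show ?thesis
      using v \<open>i < n\<close> by (auto simp: LMIN_def intro!: exI[of _ "Suc i"])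
  qed
qed

text \<open>
  The new front creates no descent, because it is followed by the relabelled old first entry
  \<open>\<pi> 1 + 1\<close>, and no descent leads into the
  maximum that is removed.
\<close>

lemma DES_last_to_front: "DES n \<sigma> = Suc ` DES n \<pi>"
proof (intro Set.set_eqI iffI)
  fix i assume "i \<in> DES n \<sigma>"
  then have i: "1 \<le> i" "i \<le> n - 1" "\<sigma> (Suc i) < \<sigma> i"
    by (auto simp: DES_def)
  have "i \<noteq> 1"
    using i(3) last_to_front_first last_to_front_Suc[of 1] n_gt_1 by auto
  then obtain i' where i': "i = Suc i'" "1 \<le> i'"
    using i by (cases i) auto
  then have "\<pi> (Suc i') < \<pi> i'"
    using i last_to_front_less_iff[of "Suc i'" i'] by simp
  then show "i \<in> Suc ` DES n \<pi>"
    using i i' by (auto simp: DES_def)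
next
  fix i assume "i \<in> Suc ` DES n \<pi>"
  then obtain i' where i': "i = Suc i'" "1 \<le> i'" "i' \<le> n - 1" "\<pi> (Suc i') < \<pi> i'"
    by (auto simp: DES_def)
  have "Suc i' \<noteq> n"
    using i' last permutes_bounds(2)[OF perm, of i'] by auto
  then have "\<sigma> (Suc (Suc i')) < \<sigma> (Suc i')"
    using i' last_to_front_less_iff[of "Suc i'" i'] by simp
  then show "i \<in> DES n \<sigma>"
    using i' \<open>Suc i' \<noteq> n\<close> by (auto simp: DES_def)
qed

lemma des_last_to_front: "des n \<sigma> = des n \<pi>"
  by (simp add: des_def DES_last_to_front card_image)

lemma iar_last_to_front: "iar n \<sigma> = Suc (iar n \<pi>)"
proof -
  have "DES n \<pi> \<noteq> {}"
    using DES_nonempty[OF perm first] n_gt_1 by simp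
  then show ?thesis
    using mono_Min_commute[of Suc "DES n \<pi>"] finite_DES
    by (simp add: iar_eq_Min_DES DES_last_to_front mono_Suc)
qed

text \<open>
  Position 1 is not the end of a component, since the first entry exceeds 1. If the first \<open>i\<close> values
  of \<open>\<pi>\<close> fill \<open>{1..i}\<close> then \<open>\<pi> 1 \<le> i\<close>, and prepending \<open>\<pi> 1\<close> after the relabelling fills
  \<open>{1..i + 1}\<close>; the converse is similar. Only the component end \<open>n\<close> has no counterpart.
\<close>

lemma COMP_last_to_front: "COMP n \<sigma> = Suc ` (COMP n \<pi> - {n})"
proof (intro Set.set_eqI iffI)
  fix i assume "i \<in> COMP n \<sigma>"
  then have i: "1 \<le> i" "i \<le> n" "\<forall>j\<in>{1..i}. \<sigma> j \<le> i"
    by (auto simp: COMP_def)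
  have "i \<noteq> 1"
    using i last_to_front_first first by auto
  then obtain i' where i': "i = Suc i'" "1 \<le> i'" "i' < n"
    using i by (cases i) auto
  have bound: "\<sigma> (Suc j) \<le> Suc i'" if "j \<in> {1..i'}" for j
    using i(3) i' that by simp
  \<comment> \<open>The relabelled first entry \<open>\<pi> 1 + 1\<close> is among the first \<open>i' + 1\<close> values. So
    \<open>\<pi> 1 \<le> i'\<close>, which bounds the small values too: the relabelling leaves them unchanged, so
    their images alone would give only the bound \<open>i' + 1\<close>.\<close>
  have "\<pi> 1 \<le> i'"
    using bound[of 1] i' last_to_front_Suc[of 1] n_gt_1 by simp
  then have "\<pi> j \<le> i'" if "j \<in> {1..i'}" for j
    using bound[OF that] last_to_front_Suc[of j] that i' by (auto split: if_splits)
  then show "i \<in> Suc ` (COMP n \<pi> - {n})"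
    using i' by (auto simp: COMP_def)
next
  fix i assume "i \<in> Suc ` (COMP n \<pi> - {n})"
  then obtain i' where "i = Suc i'" "i' \<in> COMP n \<pi>" "i' \<noteq> n"
    by blast
  then have i': "i = Suc i'" "1 \<le> i'" "i' < n" "\<forall>j\<in>{1..i'}. \<pi> j \<le> i'"
    by (auto simp: COMP_def)
  have "\<sigma> j \<le> i" if j: "j \<in> {1..i}" for j
  proof (cases "j = 1")
    case True
    then show ?thesis
      using i' last_to_front_first by (auto intro: le_SucI)
  next
    case False
    then obtain j' where j': "j = Suc j'" "j' \<in> {1..i'}"
      using j i' by (cases j) auto
    then have "\<pi> j' \<le> i'"
      using i' by blast
    moreover have "\<sigma> j \<le> Suc (\<pi> j')"
      using j' i'(3) last_to_front_Suc[of j'] by auto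
    ultimately show ?thesis
      using i'(1) by linarith
  qed
  then show "i \<in> COMP n \<sigma>"
    using i' by (auto simp: COMP_def)
qed

lemma comp_stat_last_to_front: "Suc (comp_stat n \<sigma>) = comp_stat n \<pi>"
proof -
  have "n \<in> COMP n \<pi>"
    using last_in_COMP[OF perm] n_gt_1 by simp
  then have "card (COMP n \<pi>) = Suc (card (COMP n \<pi> - {n}))"
    using finite_COMP by (intro card.remove)
  then show ?thesis
    by (simp add: comp_stat_eq_card COMP_last_to_front card_image)
qed

lemma LMAX_last_to_front:
  assumes "\<pi> \<in> perms132 n"
  shows "LMAX n \<sigma> = LMAX n \<pi>"
  using assms last_to_front_avoids_iff last_to_front_first by (simp add: LMAX_eq_interval)

lemma front_to_last_last_to_front: "front_to_last n \<sigma> = \<pi>"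
proof -
  have "inv_into UNIV (cycle (\<pi> 1) n) \<circ> cycle (\<pi> 1) n = id" "inv_into UNIV (cycle 1 n) \<circ> cycle 1 n = id"
    using cycle_permutes[of "\<pi> 1" n] cycle_permutes[of 1 n] n_gt_1 first first_le
    by (auto simp: permutes_inv_o)
  then have "inv_into UNIV (cycle (\<pi> 1) n) (cycle (\<pi> 1) n v) = v" "inv_into UNIV (cycle 1 n) (cycle 1 n v) = v" for v
    by (metis comp_apply id_apply)+
  then show ?thesis
    unfolding front_to_last_def last_to_front_first by (simp add: last_to_front_def fun_eq_iff)
qed

end

text \<open>
  An initial run of length at least two begins with \<open>m, m + 1\<close>. Removing \<open>m\<close> and undoing the
  relabelling brings back \<open>m\<close> as the first entry, so this inverts the rotation.
\<close>

lemma front_to_last: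
  assumes \<sigma>: "\<sigma> \<in> perms132 n" and first: "1 < \<sigma> 1" and iar: "2 \<le> iar n \<sigma>" and n: "2 \<le> n"
  defines "\<tau> \<equiv> front_to_last n \<sigma>"
  shows "trailing_maximum n \<tau>" "last_to_front n \<tau> = \<sigma>" "\<tau> \<in> perms132 n"
proof -
  note perm = perms132_permutes[OF \<sigma>]
  have le: "\<sigma> 1 \<le> n"
    using permutes_bounds(2)[OF perm, of 1] n by simp
  have second: "\<sigma> 2 = Suc (\<sigma> 1)"
    using second_eq_Suc_first[OF \<sigma> iar n] .
  have "\<sigma> 1 < n"
    using permutes_bounds(2)[OF perm, of 2] n second by simp
  have "inv_into UNIV (cycle (\<sigma> 1) n) (Suc (\<sigma> 1)) = \<sigma> 1"
    using first \<open>\<sigma> 1 < n\<close> by (intro inv_cycle_eq) (auto simp: cycle_def)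
  moreover have "cycle 1 n 1 = 2"
    using n by (simp add: cycle_def)
  ultimately have \<tau>_first: "\<tau> 1 = \<sigma> 1"
    by (simp add: \<tau>_def front_to_last_def second)
  have "inv_into UNIV (cycle (\<sigma> 1) n) (\<sigma> 1) = n"
    using first le by (intro inv_cycle_eq) (auto simp: cycle_def)
  moreover have "cycle 1 n n = 1"
    by (simp add: cycle_def)
  ultimately have \<tau>_last: "\<tau> n = n"
    by (simp add: \<tau>_def front_to_last_def)
  have "inv_into UNIV (cycle (\<sigma> 1) n) permutes {1..n}" "cycle 1 n permutes {1..n}"
    using n first le cycle_permutes[of 1 n] permutes_inv[OF cycle_permutes[of "\<sigma> 1" n]]
    by simp_all
  then have "\<tau> permutes {1..n}"
    unfolding \<tau>_def front_to_last_def by (metis perm permutes_compose)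
  then show tm: "trailing_maximum n \<tau>"
    using \<tau>_first \<tau>_last first by unfold_locales auto
  have "cycle (\<sigma> 1) n (inv_into UNIV (cycle (\<sigma> 1) n) v) = v" "cycle 1 n (inv_into UNIV (cycle 1 n) v) = v" for v
    using permutes_inverses(1)[OF cycle_permutes[of "\<sigma> 1" n]]
      permutes_inverses(1)[OF cycle_permutes[of 1 n]] n first le by auto
  then show eq: "last_to_front n \<tau> = \<sigma>"
    unfolding last_to_front_def \<tau>_first by (simp add: \<tau>_def front_to_last_def fun_eq_iff)
  show "\<tau> \<in> perms132 n"
    using trailing_maximum.last_to_front_avoids_iff[OF tm] \<sigma> eq by simp
qed

section \<open>Constant skew-diagonals\<close>

text \<open>
  Any statistic with this property can be carried along in the joint distribution.
\<close>

definition rotation_invariant :: "nat \<Rightarrow> ((nat \<Rightarrow> nat) \<Rightarrow> 'a) \<Rightarrow> bool" where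
  "rotation_invariant n X \<longleftrightarrow>
     (\<forall>\<pi>\<in>perms132 n. trailing_maximum n \<pi> \<longrightarrow> X (last_to_front n \<pi>) = X \<pi>)"

definition joint_count :: "nat \<Rightarrow> ((nat \<Rightarrow> nat) \<Rightarrow> 'a) \<Rightarrow> 'a \<Rightarrow> nat \<Rightarrow> nat \<Rightarrow> nat" where
  "joint_count n X x k l = card {\<pi> \<in> perms132 n. X \<pi> = x \<and> iar n \<pi> = k \<and> comp_stat n \<pi> = l}"

text \<open>
  The bounds on \<open>k\<close> and \<open>l\<close> exclude the identity on both sides, and leave a second component to
  rotate away on the left and an initial run of length at least two on the right.
\<close>

lemma joint_count_step:
  assumes X: "rotation_invariant n X" and kl: "1 \<le> k" "k < n" "1 \<le> l" "l < n"
  shows "joint_count n X x k (Suc l) = joint_count n X x (Suc k) l"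
proof -
  let ?A = "{\<pi> \<in> perms132 n. X \<pi> = x \<and> iar n \<pi> = k \<and> comp_stat n \<pi> = Suc l}"
  let ?B = "{\<pi> \<in> perms132 n. X \<pi> = x \<and> iar n \<pi> = Suc k \<and> comp_stat n \<pi> = l}"
  have A: "trailing_maximum n \<pi>" if "\<pi> \<in> ?A" for \<pi>
  proof
    show "\<pi> permutes {1..n}" "1 < \<pi> 1" "\<pi> n = n"
      using that perms132_permutes first_gt_one[of \<pi> n] last_fixed[of \<pi> n] kl by auto
  qed
  have B: "trailing_maximum n (front_to_last n \<sigma>)" "last_to_front n (front_to_last n \<sigma>) = \<sigma>"
    "front_to_last n \<sigma> \<in> perms132 n" if "\<sigma> \<in> ?B" for \<sigma>
    using front_to_last[of \<sigma> n] first_gt_one[of \<sigma> n] that kl by auto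
  have "bij_betw (last_to_front n) ?A ?B"
  proof (rule bij_betwI)
    show "last_to_front n \<in> ?A \<rightarrow> ?B"
    proof
      fix \<pi> assume \<pi>: "\<pi> \<in> ?A"
      interpret trailing_maximum n \<pi>
        by (rule A[OF \<pi>])
      show "last_to_front n \<pi> \<in> ?B"
        using \<pi> X A[OF \<pi>] last_to_front_avoids_iff iar_last_to_front comp_stat_last_to_front by (auto simp: rotation_invariant_def)
    qed
    show "front_to_last n \<in> ?B \<rightarrow> ?A"
    proof
      fix \<sigma> assume \<sigma>: "\<sigma> \<in> ?B"
      interpret trailing_maximum n "front_to_last n \<sigma>"
        by (rule B(1)[OF \<sigma>])
      have "X (front_to_last n \<sigma>) = X \<sigma>"
        using X B[OF \<sigma>] by (metis rotation_invariant_def)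
      then show "front_to_last n \<sigma> \<in> ?A"
        using \<sigma> B[OF \<sigma>] iar_last_to_front comp_stat_last_to_front by auto
    qed
    show "front_to_last n (last_to_front n \<pi>) = \<pi>" if "\<pi> \<in> ?A" for \<pi>
      using trailing_maximum.front_to_last_last_to_front[OF A[OF that]] .
    show "last_to_front n (front_to_last n \<sigma>) = \<sigma>" if "\<sigma> \<in> ?B" for \<sigma>
      using B(2)[OF that] .
  qed
  then show ?thesis
    unfolding joint_count_def by (rule bij_betw_same_card)
qed

lemma joint_count_skew:
  assumes "rotation_invariant n X" "1 \<le> k" "k + d \<le> n" "1 \<le> l" "l + d \<le> n"
  shows "joint_count n X x k (l + d) = joint_count n X x (k + d) l"
  using assms(2-)
proof (induction d arbitrary: l)
  case (Suc d)
  have "joint_count n X x k (Suc l + d) = joint_count n X x (k + d) (Suc l)"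
    using Suc.prems by (intro Suc.IH) auto
  also have "\<dots> = joint_count n X x (Suc (k + d)) l"
    using Suc.prems by (intro joint_count_step[OF assms(1)]) auto
  finally show ?case
    by simp
qed simp

lemma joint_count_hankel:
  assumes X: "rotation_invariant n X"
    and "k \<in> {1..n}" "l \<in> {1..n}" "k' \<in> {1..n}" "l' \<in> {1..n}" and sum: "k + l = k' + l'"
  shows "joint_count n X x k l = joint_count n X x k' l'"
proof (cases "k \<le> k'")
  case True
  then obtain d where "k' = k + d"
    using le_Suc_ex by blast
  moreover from this have "l = l' + d"
    using sum by simp
  ultimately show ?thesis
    using joint_count_skew[OF X, of k d l'] assms(2-5) by simp
next
  case False
  then obtain d where "k = k' + d"
    using le_Suc_ex[of k' k] by auto
  moreover from this have "l' = l + d"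
    using sum by simp
  ultimately show ?thesis
    using joint_count_skew[OF X, of k' d l] assms(2-5) by simp
qed

section \<open>Exchanging the two statistics\<close>

text \<open>
  The entries at \<open>(k, l)\<close> and \<open>(l, k)\<close> lie on the same skew-diagonal.
\<close>

lemma iar_comp_equidistributed:
  assumes X: "rotation_invariant n X" and n: "1 \<le> n"
  shows "equidistributed (perms132 n) (\<lambda>\<pi>. (X \<pi>, iar n \<pi>, comp_stat n \<pi>))
           (\<lambda>\<pi>. (X \<pi>, comp_stat n \<pi>, iar n \<pi>))"
  unfolding equidistributed_def
proof
  fix v :: "'a \<times> nat \<times> nat"
  obtain x k l where v: "v = (x, k, l)"
    by (cases v)
  have "joint_count n X x k l = joint_count n X x l k"
  proof (cases "k \<in> {1..n} \<and> l \<in> {1..n}")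
    case True
    then show ?thesis
      by (intro joint_count_hankel[OF X]) auto
  next
    case False
    have zero: "joint_count n X x a b = 0" if "\<not> (a \<in> {1..n} \<and> b \<in> {1..n})" for a b
    proof -
      have "{\<pi> \<in> perms132 n. X \<pi> = x \<and> iar n \<pi> = a \<and> comp_stat n \<pi> = b} = {}"
        using that iar_bounds[OF n] comp_stat_bounds[OF perms132_permutes n] by auto
      then show ?thesis
        unfolding joint_count_def by (simp only: card.empty)
    qed
    then show ?thesis
      using zero[of k l] zero[of l k] False by auto
  qed
  then show "card {\<pi> \<in> perms132 n. (X \<pi>, iar n \<pi>, comp_stat n \<pi>) = v} =
      card {\<pi> \<in> perms132 n. (X \<pi>, comp_stat n \<pi>, iar n \<pi>) = v}"
    by (simp add: v joint_count_def conj_commute)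
qed

text \<open>
  Grouping the summands by the value of the statistic turns each sum into a weighted sum of
  fibre sizes. The common index set must contain both images.
\<close>

lemma sum_equidistributed:
  fixes h :: "'b \<Rightarrow> 'c :: comm_semiring_1"
  assumes "finite A" and eq: "equidistributed A f g"
  shows "(\<Sum>a\<in>A. h (f a)) = (\<Sum>a\<in>A. h (g a))"
proof -
  have *: "(\<Sum>a\<in>A. h (u a)) = (\<Sum>v\<in>f ` A \<union> g ` A. of_nat (card {a \<in> A. u a = v}) * h v)"
    if "u ` A \<subseteq> f ` A \<union> g ` A" for u
  proof -
    have "(\<Sum>a\<in>A. h (u a)) = (\<Sum>v\<in>f ` A \<union> g ` A. \<Sum>a\<in>{a \<in> A. u a = v}. h (u a))"
      using that \<open>finite A\<close> by (intro sum.group[symmetric]) auto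
    also have "\<dots> = (\<Sum>v\<in>f ` A \<union> g ` A. of_nat (card {a \<in> A. u a = v}) * h v)"
      by (intro sum.cong) auto
    finally show ?thesis .
  qed
  show ?thesis
    using *[of f] *[of g] eq by (simp add: equidistributed_def)
qed

theorem theorem3p12:
  fixes n :: nat
  assumes "n \<ge> 1"
  shows "(\<forall>S T. S \<subseteq> {1..n} \<longrightarrow> T \<subseteq> {1..n} \<longrightarrow> hankel_mat (M132 n S T))
    \<and> equidistributed (perms132 n)
        (\<lambda>\<pi>. (LMAX n \<pi>, LMIN n \<pi>, iar n \<pi>, comp_stat n \<pi>))
        (\<lambda>\<pi>. (LMAX n \<pi>, LMIN n \<pi>, comp_stat n \<pi>, iar n \<pi>))
    \<and> (\<Sum>\<pi>\<in>perms132 n. (\<Prod>i\<in>LMAX n \<pi>. x_var i) * (\<Prod>i\<in>LMIN n \<pi>. y_var i)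
          * r_var ^ iar n \<pi> * p_var ^ comp_stat n \<pi>)
      = (\<Sum>\<pi>\<in>perms132 n. (\<Prod>i\<in>LMAX n \<pi>. x_var i) * (\<Prod>i\<in>LMIN n \<pi>. y_var i)
          * r_var ^ comp_stat n \<pi> * p_var ^ iar n \<pi>)
    \<and> (\<Sum>\<pi>\<in>perms132 n. t_var ^ des n \<pi> * r_var ^ iar n \<pi> * p_var ^ comp_stat n \<pi>)
      = (\<Sum>\<pi>\<in>perms132 n. t_var ^ des n \<pi> * r_var ^ comp_stat n \<pi> * p_var ^ iar n \<pi>)"
proof (intro conjI allI impI)
  have X: "rotation_invariant n (\<lambda>\<pi>. (LMAX n \<pi>, LMIN n \<pi>))"
    by (auto simp: rotation_invariant_def trailing_maximum.LMAX_last_to_front trailing_maximum.LMIN_last_to_front)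
  have D: "rotation_invariant n (des n)"
    by (auto simp: rotation_invariant_def trailing_maximum.des_last_to_front)
  show "hankel_mat (M132 n S T)" for S T
  proof -
    have dims: "dim_row (M132 n S T) = n" "dim_col (M132 n S T) = n"
      by (simp_all add: M132_def)
    have entry: "M132 n S T $$ (i, j) =
        joint_count n (\<lambda>\<pi>. (LMAX n \<pi>, LMIN n \<pi>)) (S, T) (i + 1) (j + 1)" if "i < n" "j < n" for i j
      using that by (simp add: M132_def joint_count_def conj_assoc)
    have "M132 n S T $$ (i, j) = M132 n S T $$ (i', j')"
      if "i < n" "j < n" "i' < n" "j' < n" "i + j = i' + j'" for i j i' j'
      using that by (simp only: entry) (intro joint_count_hankel[OF X], auto)
    then show ?thesis
      unfolding hankel_mat_def dims square_mat.simps by blast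
  qed
  show "equidistributed (perms132 n)
        (\<lambda>\<pi>. (LMAX n \<pi>, LMIN n \<pi>, iar n \<pi>, comp_stat n \<pi>))
        (\<lambda>\<pi>. (LMAX n \<pi>, LMIN n \<pi>, comp_stat n \<pi>, iar n \<pi>))"
    unfolding equidistributed_def
  proof
    fix v :: "nat set \<times> nat set \<times> nat \<times> nat"
    obtain S T k l where "v = (S, T, k, l)"
      by (cases v)
    then show "card {\<pi> \<in> perms132 n. (LMAX n \<pi>, LMIN n \<pi>, iar n \<pi>, comp_stat n \<pi>) = v} =
        card {\<pi> \<in> perms132 n. (LMAX n \<pi>, LMIN n \<pi>, comp_stat n \<pi>, iar n \<pi>) = v}"
      using iar_comp_equidistributed[OF X assms, unfolded equidistributed_def,
          THEN spec, of "((S, T), k, l)"]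
      by (simp add: conj_assoc)
  qed
  show "(\<Sum>\<pi>\<in>perms132 n. (\<Prod>i\<in>LMAX n \<pi>. x_var i) * (\<Prod>i\<in>LMIN n \<pi>. y_var i)
          * r_var ^ iar n \<pi> * p_var ^ comp_stat n \<pi>)
      = (\<Sum>\<pi>\<in>perms132 n. (\<Prod>i\<in>LMAX n \<pi>. x_var i) * (\<Prod>i\<in>LMIN n \<pi>. y_var i)
          * r_var ^ comp_stat n \<pi> * p_var ^ iar n \<pi>)"
    using sum_equidistributed[OF finite_perms132 iar_comp_equidistributed[OF X assms],
        where h = "\<lambda>((S, T), k, l). (\<Prod>i\<in>S. x_var i) * (\<Prod>i\<in>T. y_var i) * r_var ^ k * p_var ^ l"]
    by simp
  show "(\<Sum>\<pi>\<in>perms132 n. t_var ^ des n \<pi> * r_var ^ iar n \<pi> * p_var ^ comp_stat n \<pi>)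
      = (\<Sum>\<pi>\<in>perms132 n. t_var ^ des n \<pi> * r_var ^ comp_stat n \<pi> * p_var ^ iar n \<pi>)"
    using sum_equidistributed[OF finite_perms132 iar_comp_equidistributed[OF D assms],
        where h = "\<lambda>(d, k, l). t_var ^ d * r_var ^ k * p_var ^ l"]
    by simp
qed

end
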